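(* Let $X$ be a rack and $\mathcal{A}=(A,\phi,\psi)$ an $X$-module. Then there is an Abelian group $\operatorname{Ext}(X,\mathcal{A})$, namely $\operatorname{Ext}(X,\mathcal{A})=Z(X,\mathcal{A})/B(X,\mathcal{A})$, whose elements are in bijective correspondence with equivalence classes of extensions of $X$ by $\mathcal{A}$, the class of a factor set $\sigma\in Z(X,\mathcal{A})$ corresponding to the equivalence class of the extension $E[\mathcal{A},\sigma]$.
   Context: A rack is a set $X$ with a binary operation $(a,b)\mapsto a^b$ such that (R1) for all $a,b\in X$ there is a unique $c\in X$ with $c^b=a$; (R2) $(a^b)^c=(a^c)^{(b^c)}$ for all $a,b,c\in X$. A rack homomorphism is a function $f$ with $f(a^b)=f(a)^{f(b)}$ for all $a,b$. A rack module over $X$ (an $X$-module) is a triple $\mathcal{A}=(A,\phi,\psi)$ consisting of Abelian groups $A_x$ ($x\in X$), Abelian group isomorphisms $\phi_{x,y}\colon A_x\to A_{x^y}$ and Abelian group homomorphisms $\psi_{y,x}\colon A_y\to A_{x^y}$ ($x,y\in X$), such that for all $x,y,z\in X$: $$\phi_{x^y,z}\phi_{x,y}=\phi_{x^z,y^z}\phi_{x,z},\qquad \phi_{x^y,z}\psi_{y,x}=\psi_{y^z,x^z}\phi_{y,z},$$ $$\psi_{z,x^y}(a)=\phi_{x^z,y^z}\psi_{z,x}(a)+\psi_{y^z,x^z}\psi_{z,y}(a)\quad\text{for all } a\in A_z.$$ An extension of $X$ by $\mathcal{A}$ is a rack $E$ with a surjective rack homomorphism $f\colon E\to X$ and, writing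 $E_x=f^{-1}(x)$, for each $x\in X$ a left action of $A_x$ on $E_x$ such that: (X1) for any $u,v\in E_x$ there is a unique $a\in A_x$ with $a\cdot u=v$; (X2) $(a\cdot u)^v=\phi_{x,y}(a)\cdot(u^v)$ for all $u\in E_x$, $a\in A_x$, $v\in E_y$; (X3) $u^{(b\cdot v)}=\psi_{y,x}(b)\cdot(u^v)$ for all $u\in E_x$, $b\in A_y$, $v\in E_y$. Two extensions $f_1\colon E_1\to X$, $f_2\colon E_2\to X$ of $X$ by $\mathcal{A}$ are equivalent if there is a rack isomorphism $\theta\colon E_1\to E_2$ with $f_2\theta=f_1$ and $\theta(a\cdot u)=a\cdot\theta(u)$ for all $x\in X$, $a\in A_x$, $u\in (E_1)_x$. For a family $\sigma=\{\sigma_{x,y}\in A_{x^y}: x,y\in X\}$, $E[\mathcal{A},\sigma]$ is the set $\{(a,x): x\in X, a\in A_x\}$ with operation $(a,x)^{(b,y)}=(\phi_{x,y}(a)+\sigma_{x,y}+\psi_{y,x}(b),\,x^y)$, with projection $(a,x)\mapsto x$ and $A_x$-actions $a_1\cdot(a_2,x)=(a_1+a_2,x)$. $Z(X,\mathcal{A})$ is the set of families (factor sets) $\sigma=\{\sigma_{x,y}\in A_{x^y}: x,y\in X\}$ such that for all $x,y,z\in X$ $$\sigma_{x^y,z}+\phi_{x^y,z}(\sigma_{x,y})=\phi_{x^z,y^z}(\sigma_{x,z})+\sigma_{x^z,y^z}+\psi_{y^z,x^z}(\sigma_{y,z}),$$ with addition $(\sigma+\tau)_{x,y}=\sigma_{x,y}+\tau_{x,y}$.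 $B(X,\mathcal{A})$ is the subgroup of those $\sigma$ for which there is a family $\upsilon=\{\upsilon_x\in A_x: x\in X\}$ with $\sigma_{x,y}=\phi_{x,y}(\upsilon_x)-\upsilon_{x^y}+\psi_{y,x}(\upsilon_y)$ for all $x,y\in X$. *)

theory Defs
  imports "HOL-Algebra.Group_Action" "HOL-Algebra.Product_Groups"
begin

text \<open>
  The rack operation $a^b$ is written \<open>a \<rhd> b\<close>. Abelian groups are HOL-Algebra's
  \<open>comm_group\<close>s, hence in multiplicative notation: \<open>\<otimes>\<close>, \<open>inv\<close> stand for the
  addition and negation of the groups $A_x$.
\<close>

record 'x rack = "'x partial_object" +
  rop :: "'x \<Rightarrow> 'x \<Rightarrow> 'x" (infixl \<open>\<rhd>\<index>\<close> 75)

locale rack =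
  fixes X :: "('x, 'm) rack_scheme" (structure)
  assumes rop_closed: "\<lbrakk>a \<in> carrier X; b \<in> carrier X\<rbrakk> \<Longrightarrow> a \<rhd> b \<in> carrier X"
    and R1: "\<lbrakk>a \<in> carrier X; b \<in> carrier X\<rbrakk> \<Longrightarrow> \<exists>!c. c \<in> carrier X \<and> c \<rhd> b = a"
    and R2: "\<lbrakk>a \<in> carrier X; b \<in> carrier X; c \<in> carrier X\<rbrakk>
      \<Longrightarrow> (a \<rhd> b) \<rhd> c = (a \<rhd> c) \<rhd> (b \<rhd> c)"

definition rack_hom :: "('x, 'm) rack_scheme \<Rightarrow> ('y, 'n) rack_scheme \<Rightarrow> ('x \<Rightarrow> 'y) set"
  where "rack_hom X Y = {f \<in> carrier X \<rightarrow> carrier Y.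
    \<forall>a \<in> carrier X. \<forall>b \<in> carrier X. f (a \<rhd>\<^bsub>X\<^esub> b) = f a \<rhd>\<^bsub>Y\<^esub> f b}"

definition rack_iso :: "('x, 'm) rack_scheme \<Rightarrow> ('y, 'n) rack_scheme \<Rightarrow> ('x \<Rightarrow> 'y) set"
  where "rack_iso X Y = {f \<in> rack_hom X Y. bij_betw f (carrier X) (carrier Y)}"

text \<open>
  All groups $A_x$ of a module live in one type \<open>'a\<close>; their carriers are arbitrary and may
  overlap. \<open>phi A x y\<close> is $\phi_{x,y}\colon A_x \to A_{x^y}$ and \<open>psi A y x\<close> is
  $\psi_{y,x}\colon A_y \to A_{x^y}$.
\<close>

record ('x, 'a) rack_module =
  grp :: "'x \<Rightarrow> 'a monoid"
  phi :: "'x \<Rightarrow> 'x \<Rightarrow> 'a \<Rightarrow> 'a"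
  psi :: "'x \<Rightarrow> 'x \<Rightarrow> 'a \<Rightarrow> 'a"

locale rack_module = rack X
  for X :: "'x rack" (structure) and A :: "('x, 'a) rack_module" +
  assumes comm_group_grp: "x \<in> carrier X \<Longrightarrow> comm_group (grp A x)"
    and phi_iso: "\<lbrakk>x \<in> carrier X; y \<in> carrier X\<rbrakk> \<Longrightarrow> phi A x y \<in> iso (grp A x) (grp A (x \<rhd> y))"
    and psi_hom: "\<lbrakk>x \<in> carrier X; y \<in> carrier X\<rbrakk> \<Longrightarrow> psi A y x \<in> hom (grp A y) (grp A (x \<rhd> y))"
    and phi_phi: "\<lbrakk>x \<in> carrier X; y \<in> carrier X; z \<in> carrier X; a \<in> carrier (grp A x)\<rbrakk>
      \<Longrightarrow> phi A (x \<rhd> y) z (phi A x y a) = phi A (x \<rhd> z) (y \<rhd> z) (phi A x z a)"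
    and phi_psi: "\<lbrakk>x \<in> carrier X; y \<in> carrier X; z \<in> carrier X; a \<in> carrier (grp A y)\<rbrakk>
      \<Longrightarrow> phi A (x \<rhd> y) z (psi A y x a) = psi A (y \<rhd> z) (x \<rhd> z) (phi A y z a)"
    and psi_psi: "\<lbrakk>x \<in> carrier X; y \<in> carrier X; z \<in> carrier X; a \<in> carrier (grp A z)\<rbrakk>
      \<Longrightarrow> psi A z (x \<rhd> y) a =
          phi A (x \<rhd> z) (y \<rhd> z) (psi A z x a)
          \<otimes>\<^bsub>grp A ((x \<rhd> y) \<rhd> z)\<^esub> psi A (y \<rhd> z) (x \<rhd> z) (psi A z y a)"

text \<open>
  An extension bundles the rack $E$ with the projection $f$ and, for each $x$, the action of
  $A_x$ on the fibre over $x$: \<open>act E x a u\<close> is $a \cdot u$ for $a \in A_x$, $u \in E_x$.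
  The values of these functions outside the relevant carriers are unconstrained.
\<close>

record ('e, 'x, 'a) extension = "'e rack" +
  proj :: "'e \<Rightarrow> 'x"
  act :: "'x \<Rightarrow> 'a \<Rightarrow> 'e \<Rightarrow> 'e"

definition fibre :: "('e, 'x, 'a) extension \<Rightarrow> 'x \<Rightarrow> 'e set"
  where "fibre E x = {u \<in> carrier E. proj E u = x}"

text \<open>
  In \<open>act_action\<close> the restriction is needed because \<open>group_action\<close> asks for permutations that
  are extensional, i.e. fixed to \<open>undefined\<close> outside the set acted upon.
\<close>

locale rack_extension =
  fixes X :: "'x rack" (structure) and A :: "('x, 'a) rack_module"
    and E :: "('e, 'x, 'a) extension"
  assumes rack_E: "rack E"
    and proj_hom: "proj E \<in> rack_hom E X"
    and proj_surj: "proj E ` carrier E = carrier X"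
    and act_action: "x \<in> carrier X
      \<Longrightarrow> group_action (grp A x) (fibre E x) (\<lambda>a. restrict (act E x a) (fibre E x))"
    and X1: "\<lbrakk>x \<in> carrier X; u \<in> fibre E x; v \<in> fibre E x\<rbrakk>
      \<Longrightarrow> \<exists>!a. a \<in> carrier (grp A x) \<and> act E x a u = v"
    and X2: "\<lbrakk>x \<in> carrier X; y \<in> carrier X; u \<in> fibre E x; a \<in> carrier (grp A x); v \<in> fibre E y\<rbrakk>
      \<Longrightarrow> act E x a u \<rhd>\<^bsub>E\<^esub> v = act E (x \<rhd> y) (phi A x y a) (u \<rhd>\<^bsub>E\<^esub> v)"
    and X3: "\<lbrakk>x \<in> carrier X; y \<in> carrier X; u \<in> fibre E x; b \<in> carrier (grp A y); v \<in> fibre E y\<rbrakk>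
      \<Longrightarrow> u \<rhd>\<^bsub>E\<^esub> act E y b v = act E (x \<rhd> y) (psi A y x b) (u \<rhd>\<^bsub>E\<^esub> v)"

text \<open>The underlying sets of two equivalent extensions may have different types.\<close>

definition ext_equivalent ::
  "'x rack \<Rightarrow> ('x, 'a) rack_module \<Rightarrow> ('e, 'x, 'a) extension \<Rightarrow> ('d, 'x, 'a) extension \<Rightarrow> bool"
  where "ext_equivalent X A E1 E2 \<longleftrightarrow>
    (\<exists>\<theta> \<in> rack_iso E1 E2.
      (\<forall>u \<in> carrier E1. proj E2 (\<theta> u) = proj E1 u) \<and>
      (\<forall>x \<in> carrier X. \<forall>a \<in> carrier (grp A x). \<forall>u \<in> fibre E1 x.
        \<theta> (act E1 x a u) = act E2 x a (\<theta> u)))"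

definition extensions :: "'x rack \<Rightarrow> ('x, 'a) rack_module \<Rightarrow> ('e, 'x, 'a) extension set"
  where "extensions X A = {E. rack_extension X A E}"

definition ext_rel :: "'x rack \<Rightarrow> ('x, 'a) rack_module \<Rightarrow> ('e, 'x, 'a) extension rel"
  where "ext_rel X A =
    {(E1, E2). E1 \<in> extensions X A \<and> E2 \<in> extensions X A \<and> ext_equivalent X A E1 E2}"

definition ext_of ::
  "'x rack \<Rightarrow> ('x, 'a) rack_module \<Rightarrow> ('x \<times> 'x \<Rightarrow> 'a) \<Rightarrow> ('a \<times> 'x, 'x, 'a) extension"
  where "ext_of X A \<sigma> =
    \<lparr>carrier = {(a, x). x \<in> carrier X \<and> a \<in> carrier (grp A x)},
     rop = (\<lambda>(a, x) (b, y).
       (phi A x y a \<otimes>\<^bsub>grp A (x \<rhd>\<^bsub>X\<^esub> y)\<^esub> \<sigma> (x, y) \<otimes>\<^bsub>grp A (x \<rhd>\<^bsub>X\<^esub> y)\<^esub> psi A y x b, x \<rhd>\<^bsub>X\<^esub> y)),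
     proj = snd,
     act = (\<lambda>x a1 (a2, y). (a1 \<otimes>\<^bsub>grp A x\<^esub> a2, y))\<rparr>"

text \<open>
  Families $\{\sigma_{x,y} \in A_{x^y}\}$ are extensional functions on pairs, so that equality
  of families is equality of functions, with the pointwise group structure.
\<close>

definition families :: "'x rack \<Rightarrow> ('x, 'a) rack_module \<Rightarrow> ('x \<times> 'x \<Rightarrow> 'a) monoid"
  where "families X A =
    product_group (carrier X \<times> carrier X) (\<lambda>(x, y). grp A (x \<rhd>\<^bsub>X\<^esub> y))"

definition factor_sets :: "'x rack \<Rightarrow> ('x, 'a) rack_module \<Rightarrow> ('x \<times> 'x \<Rightarrow> 'a) set"
  where "factor_sets X A = {\<sigma> \<in> carrier (families X A).
    \<forall>x \<in> carrier X. \<forall>y \<in> carrier X. \<forall>z \<in> carrier X.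
      \<sigma> (x \<rhd>\<^bsub>X\<^esub> y, z) \<otimes>\<^bsub>grp A ((x \<rhd>\<^bsub>X\<^esub> y) \<rhd>\<^bsub>X\<^esub> z)\<^esub> phi A (x \<rhd>\<^bsub>X\<^esub> y) z (\<sigma> (x, y)) =
      phi A (x \<rhd>\<^bsub>X\<^esub> z) (y \<rhd>\<^bsub>X\<^esub> z) (\<sigma> (x, z))
        \<otimes>\<^bsub>grp A ((x \<rhd>\<^bsub>X\<^esub> y) \<rhd>\<^bsub>X\<^esub> z)\<^esub> \<sigma> (x \<rhd>\<^bsub>X\<^esub> z, y \<rhd>\<^bsub>X\<^esub> z)
        \<otimes>\<^bsub>grp A ((x \<rhd>\<^bsub>X\<^esub> y) \<rhd>\<^bsub>X\<^esub> z)\<^esub> psi A (y \<rhd>\<^bsub>X\<^esub> z) (x \<rhd>\<^bsub>X\<^esub> z) (\<sigma> (y, z))}"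

definition Z_grp :: "'x rack \<Rightarrow> ('x, 'a) rack_module \<Rightarrow> ('x \<times> 'x \<Rightarrow> 'a) monoid"
  where "Z_grp X A = families X A \<lparr>carrier := factor_sets X A\<rparr>"

definition split_families :: "'x rack \<Rightarrow> ('x, 'a) rack_module \<Rightarrow> ('x \<times> 'x \<Rightarrow> 'a) set"
  where "split_families X A = {\<sigma> \<in> carrier (families X A).
    \<exists>\<upsilon>. (\<forall>x \<in> carrier X. \<upsilon> x \<in> carrier (grp A x)) \<and>
      (\<forall>x \<in> carrier X. \<forall>y \<in> carrier X.
        \<sigma> (x, y) = phi A x y (\<upsilon> x)
          \<otimes>\<^bsub>grp A (x \<rhd>\<^bsub>X\<^esub> y)\<^esub> inv\<^bsub>grp A (x \<rhd>\<^bsub>X\<^esub> y)\<^esub> \<upsilon> (x \<rhd>\<^bsub>X\<^esub> y)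
          \<otimes>\<^bsub>grp A (x \<rhd>\<^bsub>X\<^esub> y)\<^esub> psi A y x (\<upsilon> y))}"

definition Ext :: "'x rack \<Rightarrow> ('x, 'a) rack_module \<Rightarrow> ('x \<times> 'x \<Rightarrow> 'a) set monoid"
  where "Ext X A = Z_grp X A Mod split_families X A"

end

theory Submission
  imports Defs
begin

text \<open>
  An extension \<open>E\<close> is a family of torsors, so a choice of base points \<open>s x\<close> in its fibres
  identifies \<open>E\<close> as a set with the pairs $(a, x)$, by $(a, x) \mapsto a \cdot s_x$. By (X2) and
  (X3) the operation of \<open>E\<close> is then determined by the elements $\sigma_{x,y}$ with
  $s_x^{s_y} = \sigma_{x,y} \cdot s_{x^y}$, and it is the operation of $E[\mathcal{A},\sigma]$
  (\<open>obtain_factor_set\<close>).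

  For an arbitrary family \<open>\<sigma>\<close>, the two sides of the rack identity (R2) in
  $E[\mathcal{A},\sigma]$ differ exactly by the two sides of the factor set condition
  (\<open>ext_of_R2_iff\<close>). So a factor set gives an extension, and conversely a family \<open>\<sigma>\<close> is a factor
  set as soon as $E[\mathcal{A},\sigma]$ is isomorphic to some rack (\<open>factor_set_if_rack_iso\<close>).
  This principle is applied twice: to the family obtained from base points of an extension, and
  to split families, so that \<open>B \<subseteq> Z\<close> needs no separate calculation.

  An equivalence $E[\mathcal{A},\sigma] \to E[\mathcal{A},\tau]$ commutes with the actions, so it
  is a translation $(a, x) \mapsto (a + \upsilon_x, x)$; such a translation respects the operations
  exactly when $\sigma = \delta\upsilon + \tau$, where $\delta$ is the homomorphism from families
  \<open>\<upsilon>\<close> to families \<open>\<sigma>\<close> whose image is \<open>B\<close>. Hence the extensions of two factor sets are equivalent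
  if and only if the factor sets lie in the same coset of \<open>B\<close>
  (\<open>ext_equivalent_ext_of_iff_coset\<close>), which makes the correspondence well defined and injective,
  while base points make it surjective.
\<close>

section \<open>Structure maps of a rack module\<close>

context rack_module
begin

lemma phi_hom: "x \<in> carrier X \<Longrightarrow> y \<in> carrier X \<Longrightarrow> phi A x y \<in> hom (grp A x) (grp A (x \<rhd> y))"
  using phi_iso by (simp add: iso_def)

lemma phi_closed [simp]:
  "\<lbrakk>x \<in> carrier X; y \<in> carrier X; a \<in> carrier (grp A x)\<rbrakk> \<Longrightarrow> phi A x y a \<in> carrier (grp A (x \<rhd> y))"
  using phi_hom hom_in_carrier by metis

lemma psi_closed [simp]:
  "\<lbrakk>x \<in> carrier X; y \<in> carrier X; a \<in> carrier (grp A y)\<rbrakk> \<Longrightarrow> psi A y x a \<in> carrier (grp A (x \<rhd> y))"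
  using psi_hom hom_in_carrier by metis

lemma phi_mult:
  "\<lbrakk>x \<in> carrier X; y \<in> carrier X; a \<in> carrier (grp A x); b \<in> carrier (grp A x)\<rbrakk>
    \<Longrightarrow> phi A x y (a \<otimes>\<^bsub>grp A x\<^esub> b) = phi A x y a \<otimes>\<^bsub>grp A (x \<rhd> y)\<^esub> phi A x y b"
  using phi_hom by (simp add: hom_mult)

lemma psi_mult:
  "\<lbrakk>x \<in> carrier X; y \<in> carrier X; a \<in> carrier (grp A y); b \<in> carrier (grp A y)\<rbrakk>
    \<Longrightarrow> psi A y x (a \<otimes>\<^bsub>grp A y\<^esub> b) = psi A y x a \<otimes>\<^bsub>grp A (x \<rhd> y)\<^esub> psi A y x b"
  using psi_hom by (simp add: hom_mult)

lemma group_grp: "x \<in> carrier X \<Longrightarrow> group (grp A x)"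
  using comm_group_grp comm_group.axioms(2) by blast

lemma one_grp_closed: "x \<in> carrier X \<Longrightarrow> \<one>\<^bsub>grp A x\<^esub> \<in> carrier (grp A x)"
  by (simp add: group_grp group.is_monoid monoid.one_closed)

lemma group_hom_phi:
  "x \<in> carrier X \<Longrightarrow> y \<in> carrier X \<Longrightarrow> group_hom (grp A x) (grp A (x \<rhd> y)) (phi A x y)"
  by (simp add: group_grp group_hom.intro group_hom_axioms.intro phi_hom rop_closed)

lemma group_hom_psi:
  "x \<in> carrier X \<Longrightarrow> y \<in> carrier X \<Longrightarrow> group_hom (grp A y) (grp A (x \<rhd> y)) (psi A y x)"
  by (simp add: group_grp group_hom.intro group_hom_axioms.intro psi_hom rop_closed)

lemma phi_one:
  "x \<in> carrier X \<Longrightarrow> y \<in> carrier X \<Longrightarrow> phi A x y \<one>\<^bsub>grp A x\<^esub> = \<one>\<^bsub>grp A (x \<rhd> y)\<^esub>"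
  by (rule group_hom.hom_one[OF group_hom_phi])

lemma psi_one:
  "x \<in> carrier X \<Longrightarrow> y \<in> carrier X \<Longrightarrow> psi A y x \<one>\<^bsub>grp A y\<^esub> = \<one>\<^bsub>grp A (x \<rhd> y)\<^esub>"
  by (rule group_hom.hom_one[OF group_hom_psi])

section \<open>The operation attached to a family\<close>

lemma family_closed [simp]:
  "\<lbrakk>\<sigma> \<in> carrier (families X A); x \<in> carrier X; y \<in> carrier X\<rbrakk>
    \<Longrightarrow> \<sigma> (x, y) \<in> carrier (grp A (x \<rhd> y))"
  by (auto simp: families_def PiE_iff)

lemma carrier_ext_of: "carrier (ext_of X A \<sigma>) = {(a, x). x \<in> carrier X \<and> a \<in> carrier (grp A x)}"
  by (simp add: ext_of_def)

lemma rop_ext_of: "(a, x) \<rhd>\<^bsub>ext_of X A \<sigma>\<^esub> (b, y) =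
    (phi A x y a \<otimes>\<^bsub>grp A (x \<rhd> y)\<^esub> \<sigma> (x, y) \<otimes>\<^bsub>grp A (x \<rhd> y)\<^esub> psi A y x b, x \<rhd> y)"
  by (simp add: ext_of_def)

lemma proj_ext_of: "proj (ext_of X A \<sigma>) = snd"
  by (simp add: ext_of_def)

lemma act_ext_of: "act (ext_of X A \<sigma>) x a (b, y) = (a \<otimes>\<^bsub>grp A x\<^esub> b, y)"
  by (simp add: ext_of_def)

lemma fibre_ext_of:
  "x \<in> carrier X \<Longrightarrow> fibre (ext_of X A \<sigma>) x = carrier (grp A x) \<times> {x}"
  by (auto simp: fibre_def carrier_ext_of proj_ext_of)

lemmas ext_of_simps = carrier_ext_of rop_ext_of proj_ext_of act_ext_of fibre_ext_of

text \<open>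
  Expanding both sides of (R2), the contributions of \<open>a\<close>, \<open>b\<close> and \<open>c\<close> agree by the three module
  axioms, one for each of them. What remains is the factor set condition at
  \<open>x\<close>, \<open>y\<close>, \<open>z\<close>, which is independent of \<open>a\<close>, \<open>b\<close>, \<open>c\<close>.
\<close>

lemma ext_of_R2_iff:
  fixes \<sigma>
  defines "E \<equiv> ext_of X A \<sigma>"
  assumes \<sigma>: "\<sigma> \<in> carrier (families X A)"
    and x: "x \<in> carrier X" "a \<in> carrier (grp A x)"
    and y: "y \<in> carrier X" "b \<in> carrier (grp A y)"
    and z: "z \<in> carrier X" "c \<in> carrier (grp A z)"
  shows "((a, x) \<rhd>\<^bsub>E\<^esub> (b, y)) \<rhd>\<^bsub>E\<^esub> (c, z) = ((a, x) \<rhd>\<^bsub>E\<^esub> (c, z)) \<rhd>\<^bsub>E\<^esub> ((b, y) \<rhd>\<^bsub>E\<^esub> (c, z)) \<longleftrightarrow>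
    \<sigma> (x \<rhd> y, z) \<otimes>\<^bsub>grp A ((x \<rhd> y) \<rhd> z)\<^esub> phi A (x \<rhd> y) z (\<sigma> (x, y)) =
      phi A (x \<rhd> z) (y \<rhd> z) (\<sigma> (x, z))
        \<otimes>\<^bsub>grp A ((x \<rhd> y) \<rhd> z)\<^esub> \<sigma> (x \<rhd> z, y \<rhd> z)
        \<otimes>\<^bsub>grp A ((x \<rhd> y) \<rhd> z)\<^esub> psi A (y \<rhd> z) (x \<rhd> z) (\<sigma> (y, z))"
proof -
  define w where "w = (x \<rhd> y) \<rhd> z"
  have w: "w \<in> carrier X" and w': "(x \<rhd> z) \<rhd> (y \<rhd> z) = w"
    using x y z by (simp_all add: w_def rop_closed R2[of x y z])
  interpret G: comm_group "grp A w" using w by (rule comm_group_grp)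
  note cl = rop_closed x y z \<sigma>
  interpret Gxy: comm_group "grp A (x \<rhd> y)" by (rule comm_group_grp) (simp add: cl)
  interpret Gxz: comm_group "grp A (x \<rhd> z)" by (rule comm_group_grp) (simp add: cl)
  interpret Gyz: comm_group "grp A (y \<rhd> z)" by (rule comm_group_grp) (simp add: cl)
  (* Every term lies over w, but the two sides of the identity reach w along different paths,
     equal only by R2; the facts with suffix L and R move both kinds of terms into the group
     over w, where they can be rearranged. *)
  have phiL: "t \<in> carrier (grp A (x \<rhd> y)) \<Longrightarrow> phi A (x \<rhd> y) z t \<in> carrier (grp A w)"
    and psiL: "psi A z (x \<rhd> y) c \<in> carrier (grp A w)"
    and sL: "\<sigma> (x \<rhd> y, z) \<in> carrier (grp A w)" for t
    unfolding w_def by (simp_all add: cl)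
  have phiR: "t \<in> carrier (grp A (x \<rhd> z)) \<Longrightarrow> phi A (x \<rhd> z) (y \<rhd> z) t \<in> carrier (grp A w)"
    and psiR: "t' \<in> carrier (grp A (y \<rhd> z)) \<Longrightarrow> psi A (y \<rhd> z) (x \<rhd> z) t' \<in> carrier (grp A w)"
    and sR: "\<sigma> (x \<rhd> z, y \<rhd> z) \<in> carrier (grp A w)" for t t'
    using phi_closed[of "x \<rhd> z" "y \<rhd> z" t] psi_closed[of "x \<rhd> z" "y \<rhd> z" t']
      family_closed[OF \<sigma>, of "x \<rhd> z" "y \<rhd> z"] by (simp_all add: w' cl)
  have phiL_mult: "phi A (x \<rhd> y) z (s \<otimes>\<^bsub>grp A (x \<rhd> y)\<^esub> t) =
      phi A (x \<rhd> y) z s \<otimes>\<^bsub>grp A w\<^esub> phi A (x \<rhd> y) z t"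
    if "s \<in> carrier (grp A (x \<rhd> y))" "t \<in> carrier (grp A (x \<rhd> y))" for s t
    unfolding w_def using that by (simp add: phi_mult cl)
  have phiR_mult: "phi A (x \<rhd> z) (y \<rhd> z) (s \<otimes>\<^bsub>grp A (x \<rhd> z)\<^esub> t) =
      phi A (x \<rhd> z) (y \<rhd> z) s \<otimes>\<^bsub>grp A w\<^esub> phi A (x \<rhd> z) (y \<rhd> z) t"
    if "s \<in> carrier (grp A (x \<rhd> z))" "t \<in> carrier (grp A (x \<rhd> z))" for s t
    using that by (simp add: phi_mult cl w')
  have psiR_mult: "psi A (y \<rhd> z) (x \<rhd> z) (s \<otimes>\<^bsub>grp A (y \<rhd> z)\<^esub> t) =
      psi A (y \<rhd> z) (x \<rhd> z) s \<otimes>\<^bsub>grp A w\<^esub> psi A (y \<rhd> z) (x \<rhd> z) t"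
    if "s \<in> carrier (grp A (y \<rhd> z))" "t \<in> carrier (grp A (y \<rhd> z))" for s t
    using that by (simp add: psi_mult cl w')
  let ?L = "\<sigma> (x \<rhd> y, z) \<otimes>\<^bsub>grp A w\<^esub> phi A (x \<rhd> y) z (\<sigma> (x, y))"
  let ?R = "phi A (x \<rhd> z) (y \<rhd> z) (\<sigma> (x, z)) \<otimes>\<^bsub>grp A w\<^esub> \<sigma> (x \<rhd> z, y \<rhd> z)
        \<otimes>\<^bsub>grp A w\<^esub> psi A (y \<rhd> z) (x \<rhd> z) (\<sigma> (y, z))"
  (* p collects the contributions of a, b and c, common to both sides. *)
  define p where "p = phi A (x \<rhd> z) (y \<rhd> z) (phi A x z a)
      \<otimes>\<^bsub>grp A w\<^esub> psi A (y \<rhd> z) (x \<rhd> z) (phi A y z b) \<otimes>\<^bsub>grp A w\<^esub> psi A z (x \<rhd> y) c"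
  have LRp: "?L \<in> carrier (grp A w)" "?R \<in> carrier (grp A w)" "p \<in> carrier (grp A w)"
    unfolding p_def by (simp_all add: phiL phiR psiL psiR sL sR cl)
  have "((a, x) \<rhd>\<^bsub>E\<^esub> (b, y)) \<rhd>\<^bsub>E\<^esub> (c, z) = (p \<otimes>\<^bsub>grp A w\<^esub> ?L, w)"
    unfolding E_def p_def
    by (simp add: rop_ext_of w_def[symmetric] phiL_mult cl phi_phi[OF x(1) y(1) z(1) x(2)]
        phi_psi[OF x(1) y(1) z(1) y(2)])
      (simp add: G.m_ac phiL phiR psiL psiR sL sR cl)
  moreover have "((a, x) \<rhd>\<^bsub>E\<^esub> (c, z)) \<rhd>\<^bsub>E\<^esub> ((b, y) \<rhd>\<^bsub>E\<^esub> (c, z)) = (p \<otimes>\<^bsub>grp A w\<^esub> ?R, w)"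
    unfolding E_def p_def psi_psi[OF x(1) y(1) z] w_def[symmetric]
    by (simp add: rop_ext_of w' phiR_mult psiR_mult cl)
      (simp add: G.m_ac phiL phiR psiL psiR sL sR cl)
  ultimately show ?thesis
    using LRp by (simp add: w_def[symmetric])
qed

lemma ext_of_rop_closed:
  assumes "\<sigma> \<in> carrier (families X A)" "u \<in> carrier (ext_of X A \<sigma>)" "v \<in> carrier (ext_of X A \<sigma>)"
  shows "u \<rhd>\<^bsub>ext_of X A \<sigma>\<^esub> v \<in> carrier (ext_of X A \<sigma>)"
  using assms by (auto simp: ext_of_simps rop_closed group_grp intro!: monoid.m_closed group.is_monoid)

lemma rack_ext_of:
  assumes \<sigma>: "\<sigma> \<in> factor_sets X A"
  shows "rack (ext_of X A \<sigma>)"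
proof
  let ?E = "ext_of X A \<sigma>"
  have fam: "\<sigma> \<in> carrier (families X A)" using \<sigma> by (simp add: factor_sets_def)
  show "u \<rhd>\<^bsub>?E\<^esub> v \<in> carrier ?E" if "u \<in> carrier ?E" "v \<in> carrier ?E" for u v
    using fam that by (rule ext_of_rop_closed)
  show "(u \<rhd>\<^bsub>?E\<^esub> v) \<rhd>\<^bsub>?E\<^esub> w = (u \<rhd>\<^bsub>?E\<^esub> w) \<rhd>\<^bsub>?E\<^esub> (v \<rhd>\<^bsub>?E\<^esub> w)"
    if uvw: "u \<in> carrier ?E" "v \<in> carrier ?E" "w \<in> carrier ?E" for u v w
  proof -
    obtain a x b y c z where "u = (a, x)" "v = (b, y)" "w = (c, z)" by (metis surj_pair)
    then show ?thesis
      using ext_of_R2_iff[OF fam, of x a y b z c] \<sigma> uvw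
      by (simp add: carrier_ext_of factor_sets_def)
  qed
  show "\<exists>!w. w \<in> carrier ?E \<and> w \<rhd>\<^bsub>?E\<^esub> v = u" if uv: "u \<in> carrier ?E" "v \<in> carrier ?E" for u v
  proof -
    obtain a x b y where [simp]: "u = (a, x)" "v = (b, y)" by (metis surj_pair)
    have cl: "x \<in> carrier X" "a \<in> carrier (grp A x)" "y \<in> carrier X" "b \<in> carrier (grp A y)"
      using uv by (auto simp: carrier_ext_of)
    obtain t where t: "t \<in> carrier X" "t \<rhd> y = x"
      and t_unique: "\<And>t'. t' \<in> carrier X \<Longrightarrow> t' \<rhd> y = x \<Longrightarrow> t' = t"
      using R1[OF cl(1,3)] by blast
    interpret G: comm_group "grp A x" using cl(1) by (rule comm_group_grp)
    have sp: "\<sigma> (t, y) \<in> carrier (grp A x)" "psi A y t b \<in> carrier (grp A x)"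
      using family_closed[OF fam t(1) cl(3)] psi_closed[OF t(1) cl(3,4)] t(2) by simp_all
    define q where "q = \<sigma> (t, y) \<otimes>\<^bsub>grp A x\<^esub> psi A y t b"
    have q: "q \<in> carrier (grp A x)" using sp by (simp add: q_def)
    have bij: "bij_betw (phi A t y) (carrier (grp A t)) (carrier (grp A x))"
      using phi_iso[OF t(1) cl(3)] t(2) by (simp add: iso_def)
    (* t is the only possible projection of the solution; over it the equation is affine in c
       with linear part phi A t y, hence uniquely solvable. *)
    have rop: "(c, t) \<rhd>\<^bsub>?E\<^esub> v = u \<longleftrightarrow> phi A t y c = a \<otimes>\<^bsub>grp A x\<^esub> inv\<^bsub>grp A x\<^esub> q"
      if "c \<in> carrier (grp A t)" for c
    proof -
      have "phi A t y c \<in> carrier (grp A x)" using bij that by (auto simp: bij_betw_def)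
      then have "(c, t) \<rhd>\<^bsub>?E\<^esub> v = u \<longleftrightarrow> phi A t y c \<otimes>\<^bsub>grp A x\<^esub> q = a"
        using sp by (simp add: rop_ext_of t q_def G.m_assoc)
      then show ?thesis
        using q cl \<open>phi A t y c \<in> _\<close> by (metis G.inv_solve_right')
    qed
    have "a \<otimes>\<^bsub>grp A x\<^esub> inv\<^bsub>grp A x\<^esub> q \<in> phi A t y ` carrier (grp A t)"
      using bij cl q by (simp add: bij_betw_def)
    then obtain c where c: "c \<in> carrier (grp A t)" "phi A t y c = a \<otimes>\<^bsub>grp A x\<^esub> inv\<^bsub>grp A x\<^esub> q"
      by (metis imageE)
    show ?thesis
    proof (rule ex1I[of _ "(c, t)"])
      show "(c, t) \<in> carrier ?E \<and> (c, t) \<rhd>\<^bsub>?E\<^esub> v = u"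
        using c t rop by (simp add: carrier_ext_of)
    next
      fix w assume w: "w \<in> carrier ?E \<and> w \<rhd>\<^bsub>?E\<^esub> v = u"
      obtain c' t' where [simp]: "w = (c', t')" by (metis surj_pair)
      have [simp]: "t' = t" using w t_unique by (simp add: carrier_ext_of rop_ext_of)
      have "phi A t y c' = phi A t y c" using w c rop[of c'] by (simp add: carrier_ext_of)
      then show "w = (c, t)"
        using bij w c by (simp add: carrier_ext_of bij_betw_def inj_on_def)
    qed
  qed
qed

lemma group_action_ext_of:
  assumes x: "x \<in> carrier X"
  shows "group_action (grp A x) (fibre (ext_of X A \<sigma>) x)
    (\<lambda>a. restrict (act (ext_of X A \<sigma>) x a) (fibre (ext_of X A \<sigma>) x))"
proof -
  interpret G: comm_group "grp A x" using x by (rule comm_group_grp)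
  let ?F = "carrier (grp A x) \<times> {x}"
  let ?\<rho> = "\<lambda>a. restrict (act (ext_of X A \<sigma>) x a) ?F"
  have bij: "?\<rho> a \<in> Bij ?F" if a: "a \<in> carrier (grp A x)" for a
  proof -
    have "bij_betw (?\<rho> a) ?F ?F"
      by (rule bij_betw_byWitness[where f' = "?\<rho> (inv\<^bsub>grp A x\<^esub> a)"])
        (auto simp: act_ext_of a G.m_assoc[symmetric])
    then show ?thesis by (simp add: Bij_def)
  qed
  have "?\<rho> \<in> hom (grp A x) (BijGroup ?F)"
    by (auto intro!: homI simp: BijGroup_def bij compose_def act_ext_of G.m_assoc fun_eq_iff)
  then show ?thesis
    using x by (simp add: fibre_ext_of group_action_def group_hom_def group_hom_axioms_def
        group_BijGroup)
qed

lemma rack_extension_ext_of: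
  assumes \<sigma>: "\<sigma> \<in> factor_sets X A"
  shows "rack_extension X A (ext_of X A \<sigma>)"
proof (rule rack_extension.intro)
  let ?E = "ext_of X A \<sigma>"
  have fam: "\<sigma> \<in> carrier (families X A)" using \<sigma> by (simp add: factor_sets_def)
  show "rack ?E" using \<sigma> by (rule rack_ext_of)
  show "proj ?E \<in> rack_hom ?E X"
    by (auto simp: rack_hom_def ext_of_simps)
  show "proj ?E ` carrier ?E = carrier X"
    using one_grp_closed by (force simp: ext_of_simps image_iff)
  show "group_action (grp A x) (fibre ?E x) (\<lambda>a. restrict (act ?E x a) (fibre ?E x))"
    if "x \<in> carrier X" for x
    using that by (rule group_action_ext_of)
  show "\<exists>!a. a \<in> carrier (grp A x) \<and> act ?E x a u = v"
    if "x \<in> carrier X" "u \<in> fibre ?E x" "v \<in> fibre ?E x" for x u v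
  proof -
    interpret G: comm_group "grp A x" using that(1) by (rule comm_group_grp)
    obtain b c where "u = (b, x)" "v = (c, x)" "b \<in> carrier (grp A x)" "c \<in> carrier (grp A x)"
      using \<open>u \<in> _\<close> \<open>v \<in> _\<close> by (force simp: fibre_ext_of[OF \<open>x \<in> _\<close>])
    then show ?thesis
      by (intro ex1I[of _ "c \<otimes>\<^bsub>grp A x\<^esub> inv\<^bsub>grp A x\<^esub> b"]) (auto simp: act_ext_of G.m_assoc)
  qed
  show "act ?E x a u \<rhd>\<^bsub>?E\<^esub> v = act ?E (x \<rhd> y) (phi A x y a) (u \<rhd>\<^bsub>?E\<^esub> v)"
    if "x \<in> carrier X" "y \<in> carrier X" "u \<in> fibre ?E x" "a \<in> carrier (grp A x)" "v \<in> fibre ?E y"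
    for x y u a v
  proof -
    interpret G: comm_group "grp A (x \<rhd> y)" by (rule comm_group_grp) (simp add: that rop_closed)
    show ?thesis using that fam by (auto simp: ext_of_simps phi_mult G.m_assoc)
  qed
  show "u \<rhd>\<^bsub>?E\<^esub> act ?E y b v = act ?E (x \<rhd> y) (psi A y x b) (u \<rhd>\<^bsub>?E\<^esub> v)"
    if "x \<in> carrier X" "y \<in> carrier X" "u \<in> fibre ?E x" "b \<in> carrier (grp A y)" "v \<in> fibre ?E y"
    for x y u b v
  proof -
    interpret G: comm_group "grp A (x \<rhd> y)" by (rule comm_group_grp) (simp add: that rop_closed)
    show ?thesis using that fam by (auto simp: ext_of_simps psi_mult G.m_ac)
  qed
qed

text \<open>
  An injective map compatible with the operations reflects the identity (R2), and (R2) at the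
  neutral elements of the groups is already the factor set condition. This
  serves to recognise factor sets before their extensions are known to be racks.
\<close>

lemma factor_set_if_rack_iso:
  assumes \<sigma>: "\<sigma> \<in> carrier (families X A)" and E: "rack E"
    and \<theta>: "\<theta> \<in> rack_iso (ext_of X A \<sigma>) E"
  shows "\<sigma> \<in> factor_sets X A"
proof -
  let ?D = "ext_of X A \<sigma>"
  interpret E: rack E by (rule E)
  have inj: "inj_on \<theta> (carrier ?D)" and into: "\<And>u. u \<in> carrier ?D \<Longrightarrow> \<theta> u \<in> carrier E"
    and hom: "\<And>u v. u \<in> carrier ?D \<Longrightarrow> v \<in> carrier ?D \<Longrightarrow> \<theta> (u \<rhd>\<^bsub>?D\<^esub> v) = \<theta> u \<rhd>\<^bsub>E\<^esub> \<theta> v"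
    using \<theta> by (auto simp: rack_iso_def rack_hom_def bij_betw_def)
  have R2: "(u \<rhd>\<^bsub>?D\<^esub> v) \<rhd>\<^bsub>?D\<^esub> w = (u \<rhd>\<^bsub>?D\<^esub> w) \<rhd>\<^bsub>?D\<^esub> (v \<rhd>\<^bsub>?D\<^esub> w)"
    if "u \<in> carrier ?D" "v \<in> carrier ?D" "w \<in> carrier ?D" for u v w
    using that by (intro inj_onD[OF inj]) (simp_all add: hom into ext_of_rop_closed[OF \<sigma>] E.R2)
  show ?thesis
    using \<sigma> by (auto simp: factor_sets_def R2
        ext_of_R2_iff[OF \<sigma> _ one_grp_closed _ one_grp_closed _ one_grp_closed, symmetric]
        carrier_ext_of one_grp_closed)
qed


section \<open>Cohomologous families\<close>

text \<open>
  The equation $\sigma_{x,y} = \phi_{x,y}(\upsilon_x) - \upsilon_{x^y} + \psi_{y,x}(\upsilon_y) +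
  \tau_{x,y}$, with the negative term moved to the left so that inverses do not occur in it. This
  is the form in which it expresses that a translation is a homomorphism.
\<close>

definition cohomologous_via :: "('x \<Rightarrow> 'a) \<Rightarrow> ('x \<times> 'x \<Rightarrow> 'a) \<Rightarrow> ('x \<times> 'x \<Rightarrow> 'a) \<Rightarrow> bool"
  where "cohomologous_via \<upsilon> \<sigma> \<tau> \<longleftrightarrow> (\<forall>x \<in> carrier X. \<upsilon> x \<in> carrier (grp A x)) \<and>
    (\<forall>x \<in> carrier X. \<forall>y \<in> carrier X.
      \<sigma> (x, y) \<otimes>\<^bsub>grp A (x \<rhd> y)\<^esub> \<upsilon> (x \<rhd> y) =
      phi A x y (\<upsilon> x) \<otimes>\<^bsub>grp A (x \<rhd> y)\<^esub> \<tau> (x, y) \<otimes>\<^bsub>grp A (x \<rhd> y)\<^esub> psi A y x (\<upsilon> y))"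

lemma translation_rack_iso:
  assumes \<sigma>: "\<sigma> \<in> carrier (families X A)" and \<tau>: "\<tau> \<in> carrier (families X A)"
    and \<upsilon>: "cohomologous_via \<upsilon> \<sigma> \<tau>"
  shows "(\<lambda>(a, x). (a \<otimes>\<^bsub>grp A x\<^esub> \<upsilon> x, x)) \<in> rack_iso (ext_of X A \<sigma>) (ext_of X A \<tau>)"
    (is "?\<theta> \<in> rack_iso ?S ?T")
proof -
  have \<upsilon>cl: "x \<in> carrier X \<Longrightarrow> \<upsilon> x \<in> carrier (grp A x)" for x
    using \<upsilon> by (simp add: cohomologous_via_def)
  have "?\<theta> (u \<rhd>\<^bsub>?S\<^esub> v) = ?\<theta> u \<rhd>\<^bsub>?T\<^esub> ?\<theta> v" if uv: "u \<in> carrier ?S" "v \<in> carrier ?S" for u v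
  proof -
    obtain a x b y where uv': "u = (a, x)" "v = (b, y)" by (metis surj_pair)
    have cl: "x \<in> carrier X" "a \<in> carrier (grp A x)" "y \<in> carrier X" "b \<in> carrier (grp A y)"
      using uv uv' by (auto simp: carrier_ext_of)
    interpret G: comm_group "grp A (x \<rhd> y)" by (rule comm_group_grp) (simp add: cl rop_closed)
    note clo = cl \<upsilon>cl \<sigma> \<tau> rop_closed
    have "phi A x y a \<otimes>\<^bsub>grp A (x \<rhd> y)\<^esub> \<sigma> (x, y) \<otimes>\<^bsub>grp A (x \<rhd> y)\<^esub> psi A y x b
          \<otimes>\<^bsub>grp A (x \<rhd> y)\<^esub> \<upsilon> (x \<rhd> y)
        = phi A x y a \<otimes>\<^bsub>grp A (x \<rhd> y)\<^esub> psi A y x b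
          \<otimes>\<^bsub>grp A (x \<rhd> y)\<^esub> (\<sigma> (x, y) \<otimes>\<^bsub>grp A (x \<rhd> y)\<^esub> \<upsilon> (x \<rhd> y))"
      by (simp add: G.m_ac clo)
    also have "\<sigma> (x, y) \<otimes>\<^bsub>grp A (x \<rhd> y)\<^esub> \<upsilon> (x \<rhd> y) =
        phi A x y (\<upsilon> x) \<otimes>\<^bsub>grp A (x \<rhd> y)\<^esub> \<tau> (x, y) \<otimes>\<^bsub>grp A (x \<rhd> y)\<^esub> psi A y x (\<upsilon> y)"
      using \<upsilon> cl by (simp add: cohomologous_via_def)
    finally show ?thesis
      by (simp add: uv' rop_ext_of phi_mult psi_mult G.m_ac clo)
  qed
  moreover have "bij_betw ?\<theta> (carrier ?S) (carrier ?T)"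
  proof (rule bij_betw_byWitness[where f' = "\<lambda>(a, x). (a \<otimes>\<^bsub>grp A x\<^esub> inv\<^bsub>grp A x\<^esub> \<upsilon> x, x)"])
    note G = group_grp group.is_monoid monoid.m_closed group.inv_closed monoid.m_assoc
      group.r_inv group.l_inv monoid.r_one \<upsilon>cl
    show "\<forall>u\<in>carrier ?S. (\<lambda>(a, x). (a \<otimes>\<^bsub>grp A x\<^esub> inv\<^bsub>grp A x\<^esub> \<upsilon> x, x)) (?\<theta> u) = u"
      "\<forall>u\<in>carrier ?T. ?\<theta> ((\<lambda>(a, x). (a \<otimes>\<^bsub>grp A x\<^esub> inv\<^bsub>grp A x\<^esub> \<upsilon> x, x)) u) = u"
      "?\<theta> ` carrier ?S \<subseteq> carrier ?T"
      "(\<lambda>(a, x). (a \<otimes>\<^bsub>grp A x\<^esub> inv\<^bsub>grp A x\<^esub> \<upsilon> x, x)) ` carrier ?T \<subseteq> carrier ?S"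
      by (auto simp: carrier_ext_of G)
  qed
  ultimately show ?thesis
    by (auto simp: rack_iso_def rack_hom_def bij_betw_def)
qed

text \<open>
  An equivalence commutes with the actions, and each fibre is a single orbit. It is therefore
  determined by the images $(\upsilon_x, x)$ of the elements $(0, x)$, and it is the translation by
  \<open>\<upsilon>\<close>. Evaluating it on the product of $(0, x)$ and $(0, y)$ gives the required equation.
\<close>

lemma ext_equivalent_ext_of_iff:
  assumes \<sigma>: "\<sigma> \<in> carrier (families X A)" and \<tau>: "\<tau> \<in> carrier (families X A)"
  shows "ext_equivalent X A (ext_of X A \<sigma>) (ext_of X A \<tau>) \<longleftrightarrow> (\<exists>\<upsilon>. cohomologous_via \<upsilon> \<sigma> \<tau>)"
    (is "ext_equivalent X A ?S ?T \<longleftrightarrow> _")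
proof
  assume "\<exists>\<upsilon>. cohomologous_via \<upsilon> \<sigma> \<tau>"
  then obtain \<upsilon> where \<upsilon>: "cohomologous_via \<upsilon> \<sigma> \<tau>" by blast
  have "\<upsilon> x \<in> carrier (grp A x)" if "x \<in> carrier X" for x
    using \<upsilon> that by (simp add: cohomologous_via_def)
  then show "ext_equivalent X A ?S ?T"
    unfolding ext_equivalent_def
    by (intro bexI[OF _ translation_rack_iso[OF \<sigma> \<tau> \<upsilon>]])
      (auto simp: ext_of_simps group_grp group.is_monoid monoid.m_assoc)
next
  assume "ext_equivalent X A ?S ?T"
  then obtain \<theta> where \<theta>: "\<theta> \<in> rack_iso ?S ?T"
    and over: "\<And>u. u \<in> carrier ?S \<Longrightarrow> snd (\<theta> u) = snd u"
    and equivariant: "\<And>x a b. \<lbrakk>x \<in> carrier X; a \<in> carrier (grp A x); b \<in> carrier (grp A x)\<rbrakk>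
        \<Longrightarrow> \<theta> (a \<otimes>\<^bsub>grp A x\<^esub> b, x) = act ?T x a (\<theta> (b, x))"
    unfolding ext_equivalent_def by (auto simp: ext_of_simps)
  define \<upsilon> where "\<upsilon> x = fst (\<theta> (\<one>\<^bsub>grp A x\<^esub>, x))" for x
  have into: "\<And>u. u \<in> carrier ?S \<Longrightarrow> \<theta> u \<in> carrier ?T"
    and hom: "\<And>u v. u \<in> carrier ?S \<Longrightarrow> v \<in> carrier ?S \<Longrightarrow> \<theta> (u \<rhd>\<^bsub>?S\<^esub> v) = \<theta> u \<rhd>\<^bsub>?T\<^esub> \<theta> v"
    using \<theta> by (auto simp: rack_iso_def rack_hom_def)
  have \<theta>_one: "\<theta> (\<one>\<^bsub>grp A x\<^esub>, x) = (\<upsilon> x, x)" if "x \<in> carrier X" for x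
    using over[of "(\<one>\<^bsub>grp A x\<^esub>, x)"] that one_grp_closed by (simp add: carrier_ext_of \<upsilon>_def prod_eq_iff)
  have \<upsilon>cl: "\<upsilon> x \<in> carrier (grp A x)" if "x \<in> carrier X" for x
    using into[of "(\<one>\<^bsub>grp A x\<^esub>, x)"] that one_grp_closed by (simp add: carrier_ext_of \<theta>_one)
  have l_one: "\<one>\<^bsub>grp A x\<^esub> \<otimes>\<^bsub>grp A x\<^esub> \<upsilon> x = \<upsilon> x" if "x \<in> carrier X" for x
    using that \<upsilon>cl by (simp add: group_grp group.is_monoid)
  have \<theta>_eq: "\<theta> (a, x) = (a \<otimes>\<^bsub>grp A x\<^esub> \<upsilon> x, x)" if "x \<in> carrier X" "a \<in> carrier (grp A x)" for a x
    using equivariant[OF that one_grp_closed[OF that(1)]] that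
    by (simp add: \<theta>_one act_ext_of group_grp group.is_monoid monoid.r_one)
  have "\<sigma> (x, y) \<otimes>\<^bsub>grp A (x \<rhd> y)\<^esub> \<upsilon> (x \<rhd> y) =
      phi A x y (\<upsilon> x) \<otimes>\<^bsub>grp A (x \<rhd> y)\<^esub> \<tau> (x, y) \<otimes>\<^bsub>grp A (x \<rhd> y)\<^esub> psi A y x (\<upsilon> y)"
    if "x \<in> carrier X" "y \<in> carrier X" for x y
  proof -
    interpret G: comm_group "grp A (x \<rhd> y)" by (rule comm_group_grp) (simp add: that rop_closed)
    show ?thesis
      using hom[of "(\<one>\<^bsub>grp A x\<^esub>, x)" "(\<one>\<^bsub>grp A y\<^esub>, y)"] that \<sigma>
      by (simp add: carrier_ext_of one_grp_closed rop_ext_of phi_one psi_one \<theta>_eq l_one rop_closed)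
  qed
  then have "cohomologous_via \<upsilon> \<sigma> \<tau>"
    using \<upsilon>cl by (simp add: cohomologous_via_def)
  then show "\<exists>\<upsilon>. cohomologous_via \<upsilon> \<sigma> \<tau>" by blast
qed

section \<open>Factor sets and split families as groups\<close>

lemma comm_group_families: "comm_group (families X A)"
proof -
  have grp: "comm_group (case p of (x, y) \<Rightarrow> grp A (x \<rhd> y))" if "p \<in> carrier X \<times> carrier X" for p
    using that by (auto intro: comm_group_grp rop_closed)
  then have "group (families X A)"
    unfolding families_def by (intro product_group) (simp add: comm_group.axioms(2))
  moreover have "\<sigma> \<otimes>\<^bsub>families X A\<^esub> \<tau> = \<tau> \<otimes>\<^bsub>families X A\<^esub> \<sigma>"
    if "\<sigma> \<in> carrier (families X A)" "\<tau> \<in> carrier (families X A)" for \<sigma> \<tau>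
    using that grp unfolding families_def mult_product_group
    by (intro restrict_ext comm_monoid.m_comm comm_group.axioms(1)) auto
  ultimately show ?thesis by (rule group.group_comm_groupI)
qed

lemma families_mult:
  "x \<in> carrier X \<Longrightarrow> y \<in> carrier X
    \<Longrightarrow> (\<sigma> \<otimes>\<^bsub>families X A\<^esub> \<tau>) (x, y) = \<sigma> (x, y) \<otimes>\<^bsub>grp A (x \<rhd> y)\<^esub> \<tau> (x, y)"
  by (simp add: families_def)

lemma family_eqI:
  assumes "\<sigma> \<in> carrier (families X A)" "\<tau> \<in> carrier (families X A)"
    and "\<And>x y. x \<in> carrier X \<Longrightarrow> y \<in> carrier X \<Longrightarrow> \<sigma> (x, y) = \<tau> (x, y)"
  shows "\<sigma> = \<tau>"
  using assms(1,2) unfolding families_def carrier_product_group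
  by (rule PiE_ext) (use assms(3) in auto)

text \<open>
  Both sides of each factor set condition are homomorphisms in \<open>\<sigma>\<close>, since the groups are Abelian;
  factor sets are the intersection of the equalizers of these pairs of homomorphisms.
\<close>

lemma subgroup_factor_sets: "subgroup (factor_sets X A) (families X A)"
proof -
  interpret F: comm_group "families X A" by (rule comm_group_families)
  define L where "L x y z \<sigma> =
    \<sigma> (x \<rhd> y, z) \<otimes>\<^bsub>grp A ((x \<rhd> y) \<rhd> z)\<^esub> phi A (x \<rhd> y) z (\<sigma> (x, y))" for x y z \<sigma>
  define R where "R x y z \<sigma> = phi A (x \<rhd> z) (y \<rhd> z) (\<sigma> (x, z))
    \<otimes>\<^bsub>grp A ((x \<rhd> y) \<rhd> z)\<^esub> \<sigma> (x \<rhd> z, y \<rhd> z)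
    \<otimes>\<^bsub>grp A ((x \<rhd> y) \<rhd> z)\<^esub> psi A (y \<rhd> z) (x \<rhd> z) (\<sigma> (y, z))" for x y z \<sigma>
  have eval: "(\<lambda>\<sigma>. \<sigma> (x, y)) \<in> hom (families X A) (grp A (x \<rhd> y))"
    if "x \<in> carrier X" "y \<in> carrier X" for x y
    using that by (auto intro!: homI simp: families_mult)
  have homs: "group_hom (families X A) (grp A ((x \<rhd> y) \<rhd> z)) (L x y z)
      \<and> group_hom (families X A) (grp A ((x \<rhd> y) \<rhd> z)) (R x y z)"
    if xyz: "x \<in> carrier X" "y \<in> carrier X" "z \<in> carrier X" for x y z
  proof -
    define w where "w = (x \<rhd> y) \<rhd> z"
    have w: "w \<in> carrier X" and w': "(x \<rhd> z) \<rhd> (y \<rhd> z) = w"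
      using xyz by (simp_all add: w_def rop_closed R2[of x y z])
    interpret G: comm_group "grp A w" using w by (rule comm_group_grp)
    have p1: "(\<lambda>\<sigma>. phi A (x \<rhd> y) z (\<sigma> (x, y))) \<in> hom (families X A) (grp A w)"
      using hom_compose[OF eval[of x y] phi_hom[of "x \<rhd> y" z]] xyz
      by (simp add: rop_closed w_def o_def)
    have p2: "(\<lambda>\<sigma>. phi A (x \<rhd> z) (y \<rhd> z) (\<sigma> (x, z))) \<in> hom (families X A) (grp A w)"
      using hom_compose[OF eval[of x z] phi_hom[of "x \<rhd> z" "y \<rhd> z"]] xyz
      by (simp add: rop_closed w' o_def)
    have q: "(\<lambda>\<sigma>. psi A (y \<rhd> z) (x \<rhd> z) (\<sigma> (y, z))) \<in> hom (families X A) (grp A w)"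
      using hom_compose[OF eval[of y z] psi_hom[of "x \<rhd> z" "y \<rhd> z"]] xyz
      by (simp add: rop_closed w' o_def)
    have s1: "(\<lambda>\<sigma>. \<sigma> (x \<rhd> y, z)) \<in> hom (families X A) (grp A w)"
      using eval[of "x \<rhd> y" z] xyz by (simp add: rop_closed w_def)
    have s2: "(\<lambda>\<sigma>. \<sigma> (x \<rhd> z, y \<rhd> z)) \<in> hom (families X A) (grp A w)"
      using eval[of "x \<rhd> z" "y \<rhd> z"] xyz by (simp add: rop_closed w')
    have "L x y z \<in> hom (families X A) (grp A w)"
      unfolding L_def w_def[symmetric] by (rule G.hom_group_mult[OF s1 p1])
    moreover have "R x y z \<in> hom (families X A) (grp A w)"
      unfolding R_def w_def[symmetric]
      by (rule G.hom_group_mult[OF G.hom_group_mult[OF p2 s2] q])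
    ultimately show ?thesis
      by (simp add: w_def[symmetric] group_hom_def group_hom_axioms_def F.is_group G.is_group)
  qed
  have Z: "factor_sets X A = {\<sigma> \<in> carrier (families X A).
      \<forall>x \<in> carrier X. \<forall>y \<in> carrier X. \<forall>z \<in> carrier X. L x y z \<sigma> = R x y z \<sigma>}"
    by (simp add: factor_sets_def L_def R_def)
  note hs = homs[THEN conjunct1] homs[THEN conjunct2]
  show ?thesis
  proof (rule F.subgroupI)
    show "factor_sets X A \<subseteq> carrier (families X A)" by (auto simp: Z)
    have "\<one>\<^bsub>families X A\<^esub> \<in> factor_sets X A"
      by (simp add: Z group_hom.hom_one[OF hs(1)] group_hom.hom_one[OF hs(2)])
    then show "factor_sets X A \<noteq> {}" by blast
  qed (auto simp: Z group_hom.hom_inv[OF hs(1)] group_hom.hom_inv[OF hs(2)]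
      group_hom.hom_mult[OF hs(1)] group_hom.hom_mult[OF hs(2)])
qed

text \<open>
  The families \<open>\<upsilon>\<close> in the definition of a split family are arbitrary outside the carrier of \<open>X\<close>;
  extensional ones form a group.
\<close>

definition cochains :: "('x \<Rightarrow> 'a) monoid"
  where "cochains = product_group (carrier X) (grp A)"

definition coboundary :: "('x \<Rightarrow> 'a) \<Rightarrow> 'x \<times> 'x \<Rightarrow> 'a"
  where "coboundary \<upsilon> = (\<lambda>(x, y) \<in> carrier X \<times> carrier X. phi A x y (\<upsilon> x)
    \<otimes>\<^bsub>grp A (x \<rhd> y)\<^esub> inv\<^bsub>grp A (x \<rhd> y)\<^esub> \<upsilon> (x \<rhd> y)
    \<otimes>\<^bsub>grp A (x \<rhd> y)\<^esub> psi A y x (\<upsilon> y))"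

lemma cochain_closed [simp]:
  "\<upsilon> \<in> carrier cochains \<Longrightarrow> x \<in> carrier X \<Longrightarrow> \<upsilon> x \<in> carrier (grp A x)"
  by (auto simp: cochains_def)

lemma coboundary_closed:
  "\<upsilon> \<in> carrier cochains \<Longrightarrow> coboundary \<upsilon> \<in> carrier (families X A)"
  by (auto simp: families_def coboundary_def group_grp rop_closed
      intro!: monoid.m_closed group.is_monoid)

lemma split_families_eq: "split_families X A = coboundary ` carrier cochains"
proof (intro subset_antisym subsetI)
  fix \<sigma> assume "\<sigma> \<in> split_families X A"
  then obtain \<upsilon> where \<sigma>: "\<sigma> \<in> carrier (families X A)"
    and \<upsilon>: "\<forall>x \<in> carrier X. \<upsilon> x \<in> carrier (grp A x)"
    and eq: "\<forall>x \<in> carrier X. \<forall>y \<in> carrier X. \<sigma> (x, y) = phi A x y (\<upsilon> x)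
          \<otimes>\<^bsub>grp A (x \<rhd> y)\<^esub> inv\<^bsub>grp A (x \<rhd> y)\<^esub> \<upsilon> (x \<rhd> y)
          \<otimes>\<^bsub>grp A (x \<rhd> y)\<^esub> psi A y x (\<upsilon> y)"
    by (auto simp: split_families_def)
  have \<upsilon>': "restrict \<upsilon> (carrier X) \<in> carrier cochains"
    using \<upsilon> by (simp add: cochains_def)
  have "\<sigma> = coboundary (restrict \<upsilon> (carrier X))"
    using \<sigma> coboundary_closed[OF \<upsilon>'] eq
    by (intro family_eqI) (simp_all add: coboundary_def rop_closed)
  then show "\<sigma> \<in> coboundary ` carrier cochains" using \<upsilon>' by blast
next
  fix \<sigma> assume "\<sigma> \<in> coboundary ` carrier cochains"
  then obtain \<upsilon> where "\<upsilon> \<in> carrier cochains" "\<sigma> = coboundary \<upsilon>" by blast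
  then show "\<sigma> \<in> split_families X A"
    unfolding split_families_def
    by (auto simp: coboundary_closed intro!: exI[of _ \<upsilon>]) (simp add: coboundary_def)
qed

lemma group_cochains: "group cochains"
  unfolding cochains_def by (intro product_group group_grp)

text \<open>
  This exhibits split families as the image of a homomorphism, so that they form a subgroup, and
  cohomologous families as elements of the same coset of that image.
\<close>

lemma coboundary_hom: "coboundary \<in> hom cochains (families X A)"
proof (rule homI)
  fix \<upsilon> assume "\<upsilon> \<in> carrier cochains"
  then show "coboundary \<upsilon> \<in> carrier (families X A)" by (rule coboundary_closed)
next
  fix \<upsilon> \<nu> assume \<upsilon>: "\<upsilon> \<in> carrier cochains" and \<nu>: "\<nu> \<in> carrier cochains"
  interpret C: group cochains by (rule group_cochains)
  interpret F: comm_group "families X A" by (rule comm_group_families)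
  have mult: "(\<upsilon> \<otimes>\<^bsub>cochains\<^esub> \<nu>) x = \<upsilon> x \<otimes>\<^bsub>grp A x\<^esub> \<nu> x" if "x \<in> carrier X" for x
    using that by (simp add: cochains_def)
  show "coboundary (\<upsilon> \<otimes>\<^bsub>cochains\<^esub> \<nu>) = coboundary \<upsilon> \<otimes>\<^bsub>families X A\<^esub> coboundary \<nu>"
  proof (rule family_eqI)
    fix x y assume xy: "x \<in> carrier X" "y \<in> carrier X"
    interpret G: comm_group "grp A (x \<rhd> y)" by (rule comm_group_grp) (simp add: xy rop_closed)
    have "\<upsilon> (x \<rhd> y) \<in> carrier (grp A (x \<rhd> y))" "\<nu> (x \<rhd> y) \<in> carrier (grp A (x \<rhd> y))"
      using \<upsilon> \<nu> xy by (simp_all add: rop_closed)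
    then show "coboundary (\<upsilon> \<otimes>\<^bsub>cochains\<^esub> \<nu>) (x, y) =
        (coboundary \<upsilon> \<otimes>\<^bsub>families X A\<^esub> coboundary \<nu>) (x, y)"
      using \<upsilon> \<nu> xy
      by (simp add: families_mult coboundary_def mult rop_closed phi_mult psi_mult
          G.inv_mult G.m_ac)
  qed (use \<upsilon> \<nu> in \<open>simp_all add: coboundary_closed\<close>)
qed

lemma subgroup_split_families_families: "subgroup (split_families X A) (families X A)"
proof -
  have "group_hom cochains (families X A) coboundary"
    using group_cochains comm_group_families coboundary_hom
    by (simp add: group_hom_def group_hom_axioms_def comm_group.axioms(2))
  then show ?thesis
    unfolding split_families_eq by (rule group_hom.img_is_subgroup)
qed

lemma cohomologous_via_iff:
  assumes \<sigma>: "\<sigma> \<in> carrier (families X A)" and \<tau>: "\<tau> \<in> carrier (families X A)"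
    and \<upsilon>: "\<upsilon> \<in> carrier cochains"
  shows "cohomologous_via \<upsilon> \<sigma> \<tau> \<longleftrightarrow> \<sigma> = coboundary \<upsilon> \<otimes>\<^bsub>families X A\<^esub> \<tau>"
proof -
  interpret F: comm_group "families X A" by (rule comm_group_families)
  have "\<sigma> (x, y) \<otimes>\<^bsub>grp A (x \<rhd> y)\<^esub> \<upsilon> (x \<rhd> y) =
      phi A x y (\<upsilon> x) \<otimes>\<^bsub>grp A (x \<rhd> y)\<^esub> \<tau> (x, y) \<otimes>\<^bsub>grp A (x \<rhd> y)\<^esub> psi A y x (\<upsilon> y)
      \<longleftrightarrow> \<sigma> (x, y) = (coboundary \<upsilon> \<otimes>\<^bsub>families X A\<^esub> \<tau>) (x, y)"
    if xy: "x \<in> carrier X" "y \<in> carrier X" for x y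
  proof -
    interpret G: comm_group "grp A (x \<rhd> y)" by (rule comm_group_grp) (simp add: xy rop_closed)
    let ?q = "phi A x y (\<upsilon> x) \<otimes>\<^bsub>grp A (x \<rhd> y)\<^esub> \<tau> (x, y) \<otimes>\<^bsub>grp A (x \<rhd> y)\<^esub> psi A y x (\<upsilon> y)"
    have cl: "\<sigma> (x, y) \<in> carrier (grp A (x \<rhd> y))" "\<upsilon> (x \<rhd> y) \<in> carrier (grp A (x \<rhd> y))"
      "?q \<in> carrier (grp A (x \<rhd> y))"
      using \<sigma> \<tau> \<upsilon> xy by (simp_all add: rop_closed)
    have "(coboundary \<upsilon> \<otimes>\<^bsub>families X A\<^esub> \<tau>) (x, y) =
        ?q \<otimes>\<^bsub>grp A (x \<rhd> y)\<^esub> inv\<^bsub>grp A (x \<rhd> y)\<^esub> \<upsilon> (x \<rhd> y)"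
      using cl \<tau> \<upsilon> xy by (simp add: families_mult coboundary_def G.m_ac)
    then show ?thesis
      using cl by (metis G.inv_solve_right)
  qed
  then have "cohomologous_via \<upsilon> \<sigma> \<tau> \<longleftrightarrow> (\<forall>x \<in> carrier X. \<forall>y \<in> carrier X.
      \<sigma> (x, y) = (coboundary \<upsilon> \<otimes>\<^bsub>families X A\<^esub> \<tau>) (x, y))"
    using \<upsilon> by (simp add: cohomologous_via_def)
  also have "\<dots> \<longleftrightarrow> \<sigma> = coboundary \<upsilon> \<otimes>\<^bsub>families X A\<^esub> \<tau>"
    using \<sigma> \<tau> \<upsilon> by (auto intro!: family_eqI simp: coboundary_closed)
  finally show ?thesis .
qed

lemma ext_equivalent_ext_of_iff_coset:
  assumes \<sigma>: "\<sigma> \<in> carrier (families X A)" and \<tau>: "\<tau> \<in> carrier (families X A)"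
  shows "ext_equivalent X A (ext_of X A \<sigma>) (ext_of X A \<tau>) \<longleftrightarrow>
    \<sigma> \<in> split_families X A #>\<^bsub>families X A\<^esub> \<tau>"
proof -
  have restr: "cohomologous_via (restrict \<upsilon> (carrier X)) \<sigma> \<tau>
      \<and> restrict \<upsilon> (carrier X) \<in> carrier cochains"
    if "cohomologous_via \<upsilon> \<sigma> \<tau>" for \<upsilon>
    using that by (simp add: cohomologous_via_def cochains_def rop_closed)
  have "ext_equivalent X A (ext_of X A \<sigma>) (ext_of X A \<tau>) \<longleftrightarrow>
      (\<exists>\<upsilon> \<in> carrier cochains. cohomologous_via \<upsilon> \<sigma> \<tau>)"
    unfolding ext_equivalent_ext_of_iff[OF \<sigma> \<tau>] using restr by blast
  also have "\<dots> \<longleftrightarrow> (\<exists>\<upsilon> \<in> carrier cochains. \<sigma> = coboundary \<upsilon> \<otimes>\<^bsub>families X A\<^esub> \<tau>)"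
    using cohomologous_via_iff[OF \<sigma> \<tau>] by blast
  also have "\<dots> \<longleftrightarrow> \<sigma> \<in> split_families X A #>\<^bsub>families X A\<^esub> \<tau>"
    by (auto simp: split_families_eq r_coset_def)
  finally show ?thesis .
qed

text \<open>
  A split family \<open>\<sigma>\<close> is cohomologous to the zero family, so a translation identifies its extension
  with that of zero, which is a rack.
\<close>

lemma split_families_subset: "split_families X A \<subseteq> factor_sets X A"
proof
  fix \<sigma> assume \<sigma>: "\<sigma> \<in> split_families X A"
  interpret F: comm_group "families X A" by (rule comm_group_families)
  have one: "\<one>\<^bsub>families X A\<^esub> \<in> factor_sets X A"
    using subgroup_factor_sets by (rule subgroup.one_closed)
  have fam: "\<sigma> \<in> carrier (families X A)" using \<sigma> by (simp add: split_families_def)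
  have "\<sigma> \<in> split_families X A #>\<^bsub>families X A\<^esub> \<one>\<^bsub>families X A\<^esub>"
    using \<sigma> subgroup.subset[OF subgroup_split_families_families] by simp
  then have "ext_equivalent X A (ext_of X A \<sigma>) (ext_of X A \<one>\<^bsub>families X A\<^esub>)"
    using fam by (simp add: ext_equivalent_ext_of_iff_coset)
  then obtain \<theta> where "\<theta> \<in> rack_iso (ext_of X A \<sigma>) (ext_of X A \<one>\<^bsub>families X A\<^esub>)"
    by (auto simp: ext_equivalent_def)
  then show "\<sigma> \<in> factor_sets X A"
    using factor_set_if_rack_iso[OF fam rack_ext_of[OF one]] by blast
qed

lemma comm_group_Z_grp: "comm_group (Z_grp X A)"
proof -
  interpret F: comm_group "families X A" by (rule comm_group_families)
  have "group (Z_grp X A)"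
    unfolding Z_grp_def using subgroup_factor_sets by (rule F.subgroup_imp_group)
  then show ?thesis
    using subgroup.subset[OF subgroup_factor_sets]
    by (intro group.group_comm_groupI) (auto simp: Z_grp_def intro: F.m_comm)
qed

lemma subgroup_split_families: "subgroup (split_families X A) (Z_grp X A)"
  unfolding Z_grp_def
  by (intro group.subgroup_incl subgroup_split_families_families subgroup_factor_sets
      split_families_subset comm_group.axioms(2) comm_group_families)

end

section \<open>Equivalence of extensions\<close>

lemma ext_equivalent_refl: "ext_equivalent X A E E"
  unfolding ext_equivalent_def rack_iso_def rack_hom_def
  by (intro bexI[of _ id]) (auto simp: bij_betw_id)

lemma ext_equivalent_trans:
  assumes "ext_equivalent X A E1 E2" "ext_equivalent X A E2 E3"
  shows "ext_equivalent X A E1 E3"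
proof -
  obtain \<theta> where \<theta>: "\<theta> \<in> rack_iso E1 E2" "\<forall>u \<in> carrier E1. proj E2 (\<theta> u) = proj E1 u"
      "\<forall>x \<in> carrier X. \<forall>a \<in> carrier (grp A x). \<forall>u \<in> fibre E1 x. \<theta> (act E1 x a u) = act E2 x a (\<theta> u)"
    using assms(1) by (auto simp: ext_equivalent_def)
  obtain \<eta> where \<eta>: "\<eta> \<in> rack_iso E2 E3" "\<forall>u \<in> carrier E2. proj E3 (\<eta> u) = proj E2 u"
      "\<forall>x \<in> carrier X. \<forall>a \<in> carrier (grp A x). \<forall>u \<in> fibre E2 x. \<eta> (act E2 x a u) = act E3 x a (\<eta> u)"
    using assms(2) by (auto simp: ext_equivalent_def)
  have into: "\<theta> u \<in> carrier E2" if "u \<in> carrier E1" for u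
    using \<theta>(1) that by (auto simp: rack_iso_def rack_hom_def)
  have "\<eta> \<circ> \<theta> \<in> rack_iso E1 E3"
    using \<theta>(1) \<eta>(1) into by (auto simp: rack_iso_def rack_hom_def intro: bij_betw_trans)
  then show ?thesis
    unfolding ext_equivalent_def
    by (rule bexI[rotated]) (use \<theta> \<eta> into in \<open>auto simp: fibre_def\<close>)
qed

context rack_extension
begin

lemma act_fibre:
  "\<lbrakk>x \<in> carrier X; a \<in> carrier (grp A x); u \<in> fibre E x\<rbrakk> \<Longrightarrow> act E x a u \<in> fibre E x"
  using group_action.element_image[OF act_action, of x a u] by simp

lemma act_mult:
  assumes "x \<in> carrier X" "a \<in> carrier (grp A x)" "b \<in> carrier (grp A x)" "u \<in> fibre E x"
  shows "act E x (a \<otimes>\<^bsub>grp A x\<^esub> b) u = act E x a (act E x b u)"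
  using group_action.composition_rule[OF act_action[OF assms(1)] assms(4,2,3)] assms act_fibre
  by simp

lemma rop_fibre:
  "\<lbrakk>x \<in> carrier X; y \<in> carrier X; u \<in> fibre E x; v \<in> fibre E y\<rbrakk>
    \<Longrightarrow> u \<rhd>\<^bsub>E\<^esub> v \<in> fibre E (x \<rhd> y)"
  using proj_hom rack.rop_closed[OF rack_E] by (auto simp: fibre_def rack_hom_def)

lemma proj_closed: "u \<in> carrier E \<Longrightarrow> proj E u \<in> carrier X"
  using proj_surj by blast

lemma ext_equivalent_sym:
  assumes "ext_equivalent X A E E'"
  shows "ext_equivalent X A E' E"
proof -
  obtain \<theta> where iso: "\<theta> \<in> rack_iso E E'"
    and over: "\<And>u. u \<in> carrier E \<Longrightarrow> proj E' (\<theta> u) = proj E u"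
    and equivariant: "\<And>x a u. \<lbrakk>x \<in> carrier X; a \<in> carrier (grp A x); u \<in> fibre E x\<rbrakk>
        \<Longrightarrow> \<theta> (act E x a u) = act E' x a (\<theta> u)"
    using assms by (auto simp: ext_equivalent_def)
  define \<eta> where "\<eta> = inv_into (carrier E) \<theta>"
  have bij: "bij_betw \<theta> (carrier E) (carrier E')"
    and hom: "\<And>u v. u \<in> carrier E \<Longrightarrow> v \<in> carrier E \<Longrightarrow> \<theta> (u \<rhd>\<^bsub>E\<^esub> v) = \<theta> u \<rhd>\<^bsub>E'\<^esub> \<theta> v"
    using iso by (auto simp: rack_iso_def rack_hom_def)
  have \<eta>\<theta>: "\<eta> (\<theta> u) = u" if "u \<in> carrier E" for u
    using bij that by (simp add: \<eta>_def bij_betw_inv_into_left)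
  have \<theta>\<eta>: "\<theta> (\<eta> u) = u" and \<eta>cl: "\<eta> u \<in> carrier E" if "u \<in> carrier E'" for u
    using bij that by (auto simp: \<eta>_def bij_betw_inv_into_right bij_betw_def inv_into_into)
  have "\<eta> (u \<rhd>\<^bsub>E'\<^esub> v) = \<eta> u \<rhd>\<^bsub>E\<^esub> \<eta> v" if "u \<in> carrier E'" "v \<in> carrier E'" for u v
    using that hom[of "\<eta> u" "\<eta> v"] \<eta>\<theta>[of "\<eta> u \<rhd>\<^bsub>E\<^esub> \<eta> v"] rack.rop_closed[OF rack_E] \<eta>cl
    by (simp add: \<theta>\<eta>)
  then have "\<eta> \<in> rack_iso E' E"
    using bij_betw_inv_into[OF bij] \<eta>cl by (auto simp: rack_iso_def rack_hom_def \<eta>_def)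
  moreover have "proj E (\<eta> u) = proj E' u" if "u \<in> carrier E'" for u
    using that over[of "\<eta> u"] by (simp add: \<theta>\<eta> \<eta>cl)
  moreover have "\<eta> (act E' x a u) = act E x a (\<eta> u)"
    if "x \<in> carrier X" "a \<in> carrier (grp A x)" "u \<in> fibre E' x" for x a u
  proof -
    have "\<eta> u \<in> fibre E x" and u: "u \<in> carrier E'"
      using that over[of "\<eta> u"] by (auto simp: fibre_def \<theta>\<eta> \<eta>cl)
    then show ?thesis
      using equivariant[of x a "\<eta> u"] act_fibre[of x a "\<eta> u"] that \<eta>\<theta>[of "act E x a (\<eta> u)"]
      by (simp add: \<theta>\<eta> fibre_def)
  qed
  ultimately show ?thesis
    unfolding ext_equivalent_def by (intro bexI[of _ \<eta>]) auto
qed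

end

lemma equiv_ext_rel: "equiv (extensions X A) (ext_rel X A)"
proof (rule equivI)
  show "ext_rel X A \<subseteq> extensions X A \<times> extensions X A" by (auto simp: ext_rel_def)
  show "refl_on (extensions X A) (ext_rel X A)"
    by (auto simp: refl_on_def ext_rel_def ext_equivalent_refl)
  show "sym (ext_rel X A)"
    by (auto simp: sym_def ext_rel_def extensions_def intro: rack_extension.ext_equivalent_sym)
  show "trans (ext_rel X A)"
    by (auto simp: trans_def ext_rel_def intro: ext_equivalent_trans)
qed

section \<open>Extensions come from factor sets\<close>

text \<open>
  The family \<open>\<sigma>\<close> compares the product of two base points with the base point over the product.
  By (X2) and (X3), translating base points identifies $E[\mathcal{A},\sigma]$ with \<open>E\<close>.
\<close>

lemma (in rack_module) obtain_factor_set: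
  assumes "rack_extension X A E"
  obtains \<sigma> where "\<sigma> \<in> factor_sets X A" "ext_equivalent X A (ext_of X A \<sigma>) E"
proof -
  interpret E: rack_extension X A E by (rule assms)
  have "\<forall>x \<in> carrier X. \<exists>u. u \<in> fibre E x"
    unfolding E.proj_surj[symmetric] by (auto simp: fibre_def)
  then obtain s where s: "\<And>x. x \<in> carrier X \<Longrightarrow> s x \<in> fibre E x"
    by (metis bchoice)
  define \<sigma> where "\<sigma> = (\<lambda>(x, y) \<in> carrier X \<times> carrier X.
    THE a. a \<in> carrier (grp A (x \<rhd> y)) \<and> act E (x \<rhd> y) a (s (x \<rhd> y)) = s x \<rhd>\<^bsub>E\<^esub> s y)"
  have \<sigma>: "\<sigma> (x, y) \<in> carrier (grp A (x \<rhd> y))"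
      "act E (x \<rhd> y) (\<sigma> (x, y)) (s (x \<rhd> y)) = s x \<rhd>\<^bsub>E\<^esub> s y"
    if "x \<in> carrier X" "y \<in> carrier X" for x y
    using theI'[OF E.X1[OF _ s E.rop_fibre[OF _ _ s s]], of x y] that
    by (simp_all add: \<sigma>_def rop_closed)
  have fam: "\<sigma> \<in> carrier (families X A)"
    using \<sigma>(1) by (auto simp: families_def \<sigma>_def)
  let ?D = "ext_of X A \<sigma>"
  (* Bijective because each fibre is a torsor with base point s x. *)
  define \<theta> where "\<theta> = (\<lambda>(a, x). act E x a (s x))"
  have \<theta>_fibre: "\<theta> (a, x) \<in> fibre E x" if "x \<in> carrier X" "a \<in> carrier (grp A x)" for a x
    using that s by (simp add: \<theta>_def E.act_fibre)
  have hom: "\<theta> ((a, x) \<rhd>\<^bsub>?D\<^esub> (b, y)) = \<theta> (a, x) \<rhd>\<^bsub>E\<^esub> \<theta> (b, y)"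
    if x: "x \<in> carrier X" "a \<in> carrier (grp A x)" and y: "y \<in> carrier X" "b \<in> carrier (grp A y)"
    for a x b y
  proof -
    interpret G: comm_group "grp A (x \<rhd> y)" by (rule comm_group_grp) (simp add: x y rop_closed)
    have "\<theta> ((a, x) \<rhd>\<^bsub>?D\<^esub> (b, y)) =
        act E (x \<rhd> y) (psi A y x b \<otimes>\<^bsub>grp A (x \<rhd> y)\<^esub> (phi A x y a \<otimes>\<^bsub>grp A (x \<rhd> y)\<^esub> \<sigma> (x, y)))
          (s (x \<rhd> y))"
      using x y \<sigma>(1) by (simp add: rop_ext_of \<theta>_def G.m_ac)
    also have "\<dots> = act E (x \<rhd> y) (psi A y x b) (act E (x \<rhd> y) (phi A x y a) (s x \<rhd>\<^bsub>E\<^esub> s y))"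
      using x y \<sigma> s by (simp add: E.act_mult E.act_fibre rop_closed)
    also have "\<dots> = act E x a (s x) \<rhd>\<^bsub>E\<^esub> act E y b (s y)"
      using x y s by (simp add: E.X2 E.X3 E.act_fibre)
    finally show ?thesis by (simp add: \<theta>_def)
  qed
  have "inj_on \<theta> (carrier ?D)"
  proof (rule inj_onI)
    fix u v assume uv: "u \<in> carrier ?D" "v \<in> carrier ?D" "\<theta> u = \<theta> v"
    obtain a x b y where eq: "u = (a, x)" "v = (b, y)" by (metis surj_pair)
    have cl: "x \<in> carrier X" "a \<in> carrier (grp A x)" "y \<in> carrier X" "b \<in> carrier (grp A y)"
      using uv eq by (auto simp: carrier_ext_of)
    have "x = y"
      using \<theta>_fibre[OF cl(1,2)] \<theta>_fibre[OF cl(3,4)] uv(3) eq by (simp add: fibre_def)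
    moreover have "a = b"
      using E.X1[OF cl(1) s[OF cl(1)] \<theta>_fibre[OF cl(1,2)]] uv(3) cl eq \<open>x = y\<close>
      by (auto simp: \<theta>_def)
    ultimately show "u = v" using eq by simp
  qed
  moreover have "\<theta> ` carrier ?D = carrier E"
  proof (intro subset_antisym subsetI)
    fix u assume "u \<in> \<theta> ` carrier ?D"
    then show "u \<in> carrier E" using \<theta>_fibre by (auto simp: carrier_ext_of fibre_def)
  next
    fix u assume u: "u \<in> carrier E"
    define x where "x = proj E u"
    have x: "x \<in> carrier X" "u \<in> fibre E x"
      using u E.proj_closed by (simp_all add: x_def fibre_def)
    then obtain a where "a \<in> carrier (grp A x)" "act E x a (s x) = u"
      using E.X1[OF x(1) s[OF x(1)] x(2)] by blast
    then show "u \<in> \<theta> ` carrier ?D"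
      using x(1) by (intro image_eqI[of _ _ "(a, x)"]) (simp_all add: \<theta>_def carrier_ext_of)
  qed
  ultimately have iso: "\<theta> \<in> rack_iso ?D E"
    using hom by (auto simp: rack_iso_def rack_hom_def bij_betw_def carrier_ext_of)
  have "\<sigma> \<in> factor_sets X A"
    using fam E.rack_E iso by (rule factor_set_if_rack_iso)
  moreover have "ext_equivalent X A ?D E"
    unfolding ext_equivalent_def
  proof (intro bexI[OF _ iso] conjI ballI)
    fix u assume "u \<in> carrier ?D"
    then show "proj E (\<theta> u) = proj ?D u"
      using \<theta>_fibre by (auto simp: ext_of_simps fibre_def)
  next
    fix x a u assume "x \<in> carrier X" "a \<in> carrier (grp A x)" "u \<in> fibre ?D x"
    then show "\<theta> (act ?D x a u) = act E x a (\<theta> u)"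
      using s by (auto simp: ext_of_simps \<theta>_def E.act_mult)
  qed
  ultimately show ?thesis by (rule that)
qed

section \<open>Classification of extensions\<close>

theorem theorem3p4:
  fixes X :: "'x rack" and A :: "('x, 'a) rack_module"
  assumes "rack X" and "rack_module X A"
  shows "comm_group (Z_grp X A) \<and> subgroup (split_families X A) (Z_grp X A) \<and>
    comm_group (Ext X A) \<and>
    equiv (extensions X A) (ext_rel X A :: ('a \<times> 'x, 'x, 'a) extension rel) \<and>
    (\<exists>\<Phi>. bij_betw \<Phi> (carrier (Ext X A))
          (extensions X A // (ext_rel X A :: ('a \<times> 'x, 'x, 'a) extension rel)) \<and>
       (\<forall>\<sigma> \<in> factor_sets X A.
          \<Phi> (split_families X A #>\<^bsub>Z_grp X A\<^esub> \<sigma>) = ext_rel X A `` {ext_of X A \<sigma>})) \<and>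
    (\<forall>E :: ('e, 'x, 'a) extension. rack_extension X A E \<longrightarrow>
       {\<sigma> \<in> factor_sets X A. ext_equivalent X A E (ext_of X A \<sigma>)} \<in> carrier (Ext X A))"
proof -
  interpret rack_module X A by (rule assms(2))
  interpret Z: comm_group "Z_grp X A" by (rule comm_group_Z_grp)
  let ?B = "split_families X A" and ?Z = "factor_sets X A"
  let ?r = "ext_rel X A :: ('a \<times> 'x, 'x, 'a) extension rel"
  let ?coset = "\<lambda>\<sigma>. ?B #>\<^bsub>Z_grp X A\<^esub> \<sigma>"
  note B = subgroup_split_families
  have carrier_Z: "carrier (Z_grp X A) = ?Z" by (simp add: Z_grp_def)
  have carrier_Ext: "carrier (Ext X A) = ?coset ` ?Z"
    by (simp add: Ext_def carrier_FactGroup carrier_Z)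
  have fam: "\<sigma> \<in> carrier (families X A)" if "\<sigma> \<in> ?Z" for \<sigma>
    using that by (simp add: factor_sets_def)
  have coset: "?coset \<tau> = {\<sigma> \<in> ?Z. ext_equivalent X A (ext_of X A \<sigma>) (ext_of X A \<tau>)}"
    if "\<tau> \<in> ?Z" for \<tau>
  proof -
    have "?coset \<tau> \<subseteq> ?Z"
      using Z.r_coset_subset_G[OF subgroup.subset[OF B], of \<tau>] that carrier_Z by simp
    then show ?thesis
      using that by (auto simp: ext_equivalent_ext_of_iff_coset fam Z_grp_def)
  qed
  have ext: "ext_of X A \<sigma> \<in> extensions X A" if "\<sigma> \<in> ?Z" for \<sigma>
    using that by (simp add: extensions_def rack_extension_ext_of)
  have rel_iff: "(ext_of X A \<sigma>, ext_of X A \<tau>) \<in> ?r \<longleftrightarrow> \<sigma> \<in> ?coset \<tau>"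
    if "\<sigma> \<in> ?Z" "\<tau> \<in> ?Z" for \<sigma> \<tau>
    using that ext by (auto simp: ext_rel_def coset)
  have equiv: "equiv (extensions X A) ?r" by (rule equiv_ext_rel)
  (* By rel_iff the members of a coset have equivalent extensions, so this union over a whole
     coset is a single equivalence class and no representative has to be chosen. *)
  define \<Phi> where "\<Phi> C = ?r `` (ext_of X A ` C)" for C
  have \<Phi>: "\<Phi> (?coset \<sigma>) = ?r `` {ext_of X A \<sigma>}" if \<sigma>: "\<sigma> \<in> ?Z" for \<sigma>
  proof -
    have "?r `` {ext_of X A \<tau>} = ?r `` {ext_of X A \<sigma>}" if "\<tau> \<in> ?coset \<sigma>" for \<tau>
      using that \<sigma> rel_iff coset by (intro equiv_class_eq[OF equiv]) blast
    moreover have "\<sigma> \<in> ?coset \<sigma>"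
      using \<sigma> B by (simp add: Z.rcos_self carrier_Z)
    ultimately show ?thesis unfolding \<Phi>_def by blast
  qed
  have "inj_on \<Phi> (carrier (Ext X A))"
  proof (rule inj_onI)
    fix C D assume "C \<in> carrier (Ext X A)" "D \<in> carrier (Ext X A)" "\<Phi> C = \<Phi> D"
    then obtain \<sigma> \<tau> where st: "\<sigma> \<in> ?Z" "C = ?coset \<sigma>" "\<tau> \<in> ?Z" "D = ?coset \<tau>"
      by (auto simp: carrier_Ext)
    then have "?r `` {ext_of X A \<sigma>} = ?r `` {ext_of X A \<tau>}"
      using \<open>\<Phi> C = \<Phi> D\<close> by (simp add: \<Phi>)
    then have "\<sigma> \<in> ?coset \<tau>"
      using eq_equiv_class[OF _ equiv ext] st rel_iff by blast
    then show "C = D" using Z.repr_independence[OF _ _ B] st carrier_Z by simp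
  qed
  moreover have "\<Phi> ` carrier (Ext X A) = extensions X A // ?r"
  proof (intro subset_antisym subsetI)
    fix Q assume "Q \<in> \<Phi> ` carrier (Ext X A)"
    then show "Q \<in> extensions X A // ?r"
      using ext by (auto simp: carrier_Ext \<Phi> intro!: quotientI)
  next
    fix Q assume "Q \<in> extensions X A // ?r"
    then obtain E where E: "E \<in> extensions X A" "Q = ?r `` {E}" by (rule quotientE)
    then obtain \<sigma> where \<sigma>: "\<sigma> \<in> ?Z" "ext_equivalent X A (ext_of X A \<sigma>) E"
      using obtain_factor_set by (auto simp: extensions_def)
    then have "(ext_of X A \<sigma>, E) \<in> ?r" using E ext by (simp add: ext_rel_def)
    then have "Q = \<Phi> (?coset \<sigma>)"
      using equiv_class_eq[OF equiv] \<sigma>(1) E(2) by (simp add: \<Phi>)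
    then show "Q \<in> \<Phi> ` carrier (Ext X A)" using \<sigma>(1) by (auto simp: carrier_Ext)
  qed
  ultimately have bij: "bij_betw \<Phi> (carrier (Ext X A)) (extensions X A // ?r)"
    by (simp add: bij_betw_def)
  have coset_of_ext: "{\<sigma> \<in> ?Z. ext_equivalent X A E (ext_of X A \<sigma>)} \<in> carrier (Ext X A)"
    if E: "rack_extension X A E" for E :: "('e, 'x, 'a) extension"
  proof -
    obtain \<tau> where \<tau>: "\<tau> \<in> ?Z" "ext_equivalent X A (ext_of X A \<tau>) E"
      using obtain_factor_set[OF E] by blast
    note sym = rack_extension.ext_equivalent_sym
    have "ext_equivalent X A E (ext_of X A \<sigma>) \<longleftrightarrow>
        ext_equivalent X A (ext_of X A \<sigma>) (ext_of X A \<tau>)" if "\<sigma> \<in> ?Z" for \<sigma>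
      using \<tau> sym[OF E] sym[OF rack_extension_ext_of] that ext_equivalent_trans by metis
    then have "{\<sigma> \<in> ?Z. ext_equivalent X A E (ext_of X A \<sigma>)} = ?coset \<tau>"
      using coset[OF \<tau>(1)] by auto
    then show ?thesis using \<tau>(1) by (auto simp: carrier_Ext)
  qed
  have "comm_group (Ext X A)"
    unfolding Ext_def using B by (rule Z.abelian_FactGroup)
  then show ?thesis
    using Z.comm_group_axioms B equiv bij \<Phi> coset_of_ext by blast
qed

end
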